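(* For every positive integer $n$, $$\sum_{\substack{k,\ell\ge 0\\ k+\ell<n}} u^k v^\ell \sum_{w\in \mathrm{SW}(1^n,k,\ell)} q^{\mathrm{sminv}(w)} \;=\; \sum_{\pi\in\Pi(n)_{>0}} u^{\deg_\theta(\pi)}\, v^{\deg_\xi(\pi)}\, \mathrm{stair}_q(\pi).$$
   Context: **Left side.** A segmented permutation of length $n$ is a permutation $\sigma_1\cdots\sigma_n$ of $\{1,\ldots,n\}$ cut into consecutive nonempty blocks. An ascent (resp. descent) is an index $i$ such that $\sigma_i,\sigma_{i+1}$ lie in the same block and $\sigma_i<\sigma_{i+1}$ (resp. $\sigma_i>\sigma_{i+1}$). $\mathrm{SW}(1^n,k,\ell)$ is the set of segmented permutations of length $n$ with exactly $k$ ascents and exactly $\ell$ descents. A sminversion of $\sigma$ is a pair $(i,j)$ with $1\le i<j\le n$, $\sigma_i>\sigma_j$, and either $\sigma_j$ is the first letter of its block or $\sigma_{j-1}>\sigma_i$. $\mathrm{sminv}(\sigma)$ is the number of sminversions. **Right side.** $\Pi(n)_{>0}$ is the set of modified Motzkin paths of length $n$: lattice paths $\pi=(p_1,\ldots,p_n)$ in $\mathbb{Z}^2$ starting at $(0,0)$ whose $i$-th step $p_i$ is one of: an (undecorated) up-step $(1,1)$; a horizontal step $(1,0)$ with decoration $\theta_i$; a horizontal step $(1,0)$ with decoration $\xi_i$; a down-step $(1,-1)$ with decoration $\theta_i\xi_i$; such that the first step is an up-step and afterwards the path never goes below the line $y=1$. Let $T(\pi)$ (resp. $S(\pi)$) be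 the set of indices $i$ such that $\theta_i$ (resp. $\xi_i$) occurs in the decoration of $p_i$, and $\deg_\theta(\pi)=|T(\pi)|$, $\deg_\xi(\pi)=|S(\pi)|$. For $T,S\subseteq\{2,\ldots,n\}$ define $\alpha(T,S)$ by $\alpha_1(T,S)=0$ and, for $2\le i\le n$, $\alpha_i(T,S)=\alpha_{i-1}(T,S)-1+\chi(i\notin T)+\chi(i\notin S)$, where $\chi(P)=1$ if $P$ is true and $0$ otherwise. With $[m]_q=1+q+\cdots+q^{m-1}$, put $\mathrm{stair}_q(\pi)=\prod_{i=1}^n[\alpha_i(T(\pi),S(\pi))+1]_q$. *)

theory Defs
  imports Main
begin

section \<open>Segmented permutations\<close>

text \<open>A segmented permutation is represented by the list of its blocks. Positions are
  1-based, as in \<open>\<sigma>\<^sub>1 \<dots> \<sigma>\<^sub>n\<close>.\<close>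

definition segmented_perm :: "nat \<Rightarrow> nat list list \<Rightarrow> bool" where
  "segmented_perm n bs \<longleftrightarrow>
     [] \<notin> set bs \<and> distinct (concat bs) \<and> set (concat bs) = {1..n}"

definition letter :: "nat list list \<Rightarrow> nat \<Rightarrow> nat" where
  "letter bs i = concat bs ! (i - 1)"

text \<open>The letters of a segmented permutation are pairwise distinct, so the block of a
  position is determined by the letter at that position.\<close>

definition same_block :: "nat list list \<Rightarrow> nat \<Rightarrow> nat \<Rightarrow> bool" where
  "same_block bs i j \<longleftrightarrow> (\<exists>b\<in>set bs. letter bs i \<in> set b \<and> letter bs j \<in> set b)"

definition first_in_block :: "nat list list \<Rightarrow> nat \<Rightarrow> bool" where
  "first_in_block bs j \<longleftrightarrow> (\<exists>b\<in>set bs. letter bs j = hd b)"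

definition ascents :: "nat list list \<Rightarrow> nat set" where
  "ascents bs = {i. 1 \<le> i \<and> i < length (concat bs) \<and>
     same_block bs i (i + 1) \<and> letter bs i < letter bs (i + 1)}"

definition descents :: "nat list list \<Rightarrow> nat set" where
  "descents bs = {i. 1 \<le> i \<and> i < length (concat bs) \<and>
     same_block bs i (i + 1) \<and> letter bs i > letter bs (i + 1)}"

definition SW :: "nat \<Rightarrow> nat \<Rightarrow> nat \<Rightarrow> nat list list set" where
  "SW n k l = {bs. segmented_perm n bs \<and> card (ascents bs) = k \<and> card (descents bs) = l}"

definition sminversions :: "nat list list \<Rightarrow> (nat \<times> nat) set" where
  "sminversions bs = {(i, j). 1 \<le> i \<and> i < j \<and> j \<le> length (concat bs) \<and>
     letter bs i > letter bs j \<and>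
     (first_in_block bs j \<or> letter bs (j - 1) > letter bs i)}"

definition sminv :: "nat list list \<Rightarrow> nat" where
  "sminv bs = card (sminversions bs)"

section \<open>Modified Motzkin paths\<close>

text \<open>The subscript of a decoration is always the index of the step carrying it, so only
  the kinds of the decorating symbols are recorded.\<close>

datatype step = Up | Hor_theta | Hor_xi | Down_theta_xi

datatype symbol = Theta | Xi

fun step_vector :: "step \<Rightarrow> int \<times> int" where
  "step_vector Up = (1, 1)"
| "step_vector Hor_theta = (1, 0)"
| "step_vector Hor_xi = (1, 0)"
| "step_vector Down_theta_xi = (1, -1)"

fun decoration :: "step \<Rightarrow> symbol set" where
  "decoration Up = {}"
| "decoration Hor_theta = {Theta}"
| "decoration Hor_xi = {Xi}"
| "decoration Down_theta_xi = {Theta, Xi}"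

definition path_y :: "step list \<Rightarrow> nat \<Rightarrow> int" where
  "path_y p i = (\<Sum>s\<leftarrow>take i p. snd (step_vector s))"

definition motzkin_paths :: "nat \<Rightarrow> step list set" where
  "motzkin_paths n = {p. length p = n \<and> p \<noteq> [] \<and> hd p = Up \<and> (\<forall>i\<in>{1..n}. path_y p i \<ge> 1)}"

definition theta_set :: "step list \<Rightarrow> nat set" where
  "theta_set p = {i. 1 \<le> i \<and> i \<le> length p \<and> Theta \<in> decoration (p ! (i - 1))}"

definition xi_set :: "step list \<Rightarrow> nat set" where
  "xi_set p = {i. 1 \<le> i \<and> i \<le> length p \<and> Xi \<in> decoration (p ! (i - 1))}"

definition deg_theta :: "step list \<Rightarrow> nat" where
  "deg_theta p = card (theta_set p)"

definition deg_xi :: "step list \<Rightarrow> nat" where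
  "deg_xi p = card (xi_set p)"

text \<open>The value at index 0 is a dummy. For arbitrary \<open>T\<close> and \<open>S\<close> the entries may be
  negative, hence the type \<^typ>\<open>int\<close>.\<close>

fun alpha :: "nat set \<Rightarrow> nat set \<Rightarrow> nat \<Rightarrow> int" where
  "alpha T S 0 = 0"
| "alpha T S (Suc 0) = 0"
| "alpha T S (Suc (Suc i)) = alpha T S (Suc i) - 1
     + of_bool (Suc (Suc i) \<notin> T) + of_bool (Suc (Suc i) \<notin> S)"

text \<open>The truncation of negative arguments is immaterial below: on the paths in
  \<open>motzkin_paths n\<close> all entries of \<open>alpha\<close> are nonnegative.\<close>

definition q_int :: "'a::comm_semiring_1 \<Rightarrow> int \<Rightarrow> 'a" where
  "q_int q m = (\<Sum>j<nat m. q ^ j)"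

definition stair :: "'a::comm_semiring_1 \<Rightarrow> step list \<Rightarrow> 'a" where
  "stair q p = (\<Prod>i=1..length p. q_int q (alpha (theta_set p) (xi_set p) i + 1))"

end

theory Submission
  imports Defs
begin

text \<open>
  Let \<open>r\<close> be the number of blocks of a segmented permutation, and the final height of a path.
  Deleting the largest letter \<open>n + 1\<close> from a block removes an ascent if something precedes
  it in the block and a descent if something follows it; the block disappears, gets shorter or is
  cut in two accordingly. A letter that follows \<open>n + 1\<close> in its block becomes the first of
  its block, so it keeps its sminversions, and the only sminversions lost are those of \<open>n + 1\<close>
  with the first letters of the later blocks. As the block of \<open>n + 1\<close> can be any of the \<open>r\<close>
  blocks, this yields
  \<open>F (n + 1) r = [r]\<^sub>q (F n (r - 1) + (u + v) F n r + u v F n (r + 1))\<close>.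
  On a path \<open>\<alpha>\<^sub>i + 1\<close> is the height after the \<open>i\<close>-th step, so deleting the last step gives
  the same recurrence.
\<close>

section \<open>Statistics of block lists computed letter by letter\<close>

fun adj :: "(nat \<Rightarrow> nat \<Rightarrow> bool) \<Rightarrow> nat list \<Rightarrow> nat" where
  "adj R (a # b # xs) = of_bool (R a b) + adj R (b # xs)"
| "adj R _ = 0"

text \<open>\<open>A\<close> collects the letters read so far, and \<open>P\<close> is the condition "at the first letter of
  a block anything, otherwise smaller than the previous letter" of a sminversion.\<close>

fun block_inv :: "nat set \<Rightarrow> (nat \<Rightarrow> bool) \<Rightarrow> nat list \<Rightarrow> nat" where
  "block_inv A P [] = 0"
| "block_inv A P (b # xs) =
     card {a \<in> A. b < a \<and> P a} + block_inv (insert b A) (\<lambda>a. a < b) xs"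

fun seg_inv :: "nat set \<Rightarrow> nat list list \<Rightarrow> nat" where
  "seg_inv A [] = 0"
| "seg_inv A (b # bs) = block_inv A (\<lambda>_. True) b + seg_inv (A \<union> set b) bs"

text \<open>The relation is a parameter so that \<open>(<)\<close> yields ascents,
  \<open>(>)\<close> yields descents, and every fact is proved once for both.\<close>

definition seg_adj :: "(nat \<Rightarrow> nat \<Rightarrow> bool) \<Rightarrow> nat list list \<Rightarrow> nat" where
  "seg_adj R bs = (\<Sum>b\<leftarrow>bs. adj R b)"

lemma seg_adj_simps [simp]:
  "seg_adj R [] = 0" "seg_adj R (b # bs) = adj R b + seg_adj R bs"
  "seg_adj R (bs @ cs) = seg_adj R bs + seg_adj R cs"
  by (simp_all add: seg_adj_def)

lemma adj_append:
  "adj R (xs @ c # ys) = adj R xs + of_bool (xs \<noteq> [] \<and> R (last xs) c) + adj R (c # ys)"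
  by (induction R xs rule: adj.induct) auto

lemma adj_Cons: "adj R (c # ys) = of_bool (ys \<noteq> [] \<and> R c (hd ys)) + adj R ys"
  by (cases ys) auto

lemma adj_less_plus_greater:
  "distinct b \<Longrightarrow> b \<noteq> [] \<Longrightarrow> adj (<) b + adj (>) b + 1 = length b"
proof (induction b)
  case (Cons a b)
  then show ?case by (cases b) auto
qed simp

text \<open>\<open>P\<close> is consulted only at the first letter of the block, so \<open>c\<close>
  sees it only if \<open>xs = []\<close>. Behind \<open>c\<close> the condition depends on
  \<open>c\<close> alone.\<close>

lemma block_inv_append:
  "block_inv A P (xs @ c # ys) = block_inv A P xs
     + card {a \<in> A \<union> set xs. c < a \<and> (if xs = [] then P a else a < last xs)}
     + block_inv (insert c (A \<union> set xs)) (\<lambda>a. a < c) ys"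
  by (induction xs arbitrary: A P) (auto simp: insert_commute Un_commute)

lemma block_inv_cong:
  "(\<And>a. a \<in> A \<Longrightarrow> P a = Q a) \<Longrightarrow> block_inv A P ys = block_inv A Q ys"
  by (cases ys) (auto intro: arg_cong[where f = card])

text \<open>An earlier letter \<open>m\<close> could only form a sminversion with a letter of
  \<open>ys\<close> if \<open>P m\<close> held at the first letter or some later letter were
  preceded by one above \<open>m\<close>. Both are excluded.\<close>

lemma block_inv_insert:
  assumes "\<forall>a\<in>set ys. a < m" "\<not> P m"
  shows "block_inv (insert m A) P ys = block_inv A P ys"
  using assms
proof (induction ys arbitrary: A P)
  case (Cons b ys)
  have "{a \<in> insert m A. b < a \<and> P a} = {a \<in> A. b < a \<and> P a}"
    using Cons.prems by auto
  moreover have "block_inv (insert b (insert m A)) (\<lambda>a. a < b) ys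
      = block_inv (insert b A) (\<lambda>a. a < b) ys"
    using Cons.IH[of "\<lambda>a. a < b" "insert b A"] Cons.prems by (simp add: insert_commute)
  ultimately show ?case by simp
qed simp

text \<open>At the start of a block the condition holds for \<open>m\<close> as well, which gives
  one new pair. Behind the first letter \<open>block_inv_insert\<close> applies.\<close>

lemma block_inv_insert_first:
  assumes "\<forall>a\<in>set ys. a < m" "ys \<noteq> []" "m \<notin> A" "finite A"
  shows "block_inv (insert m A) (\<lambda>_. True) ys = Suc (block_inv A (\<lambda>_. True) ys)"
proof -
  obtain b zs where ys: "ys = b # zs" using assms by (cases ys) auto
  have "{a \<in> insert m A. b < a} = insert m {a \<in> A. b < a}"
    using assms ys by auto
  moreover have "block_inv (insert b (insert m A)) (\<lambda>a. a < b) zs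
      = block_inv (insert b A) (\<lambda>a. a < b) zs"
    using block_inv_insert[of zs m "\<lambda>a. a < b" "insert b A"] assms ys
    by (simp add: insert_commute)
  ultimately show ?thesis using assms by (simp add: ys)
qed

text \<open>No letter exceeds \<open>m\<close>, so \<open>m\<close> is not the right end of a
  sminversion. Behind \<open>m\<close> the condition \<open>a < m\<close> holds for all letters
  other than \<open>m\<close>, so \<open>ys\<close> counts as if it opened a block of its
  own.\<close>

lemma block_inv_max:
  assumes "\<forall>a\<in>A \<union> set xs \<union> set ys. a < m"
  shows "block_inv A (\<lambda>_. True) (xs @ m # ys)
    = block_inv A (\<lambda>_. True) xs + block_inv (A \<union> set xs) (\<lambda>_. True) ys"
proof -
  have "{a \<in> A \<union> set xs. m < a \<and> (if xs = [] then True else a < last xs)} = {}"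
    using assms by (auto dest: less_asym)
  moreover have "block_inv (insert m (A \<union> set xs)) (\<lambda>a. a < m) ys
      = block_inv (A \<union> set xs) (\<lambda>a. a < m) ys"
    by (rule block_inv_insert) (use assms in auto)
  moreover have "\<dots> = block_inv (A \<union> set xs) (\<lambda>_. True) ys"
    by (rule block_inv_cong) (use assms in auto)
  ultimately show ?thesis unfolding block_inv_append by (simp only: card.empty)
qed

lemma seg_inv_append:
  "seg_inv A (bs @ cs) = seg_inv A bs + seg_inv (A \<union> set (concat bs)) cs"
  by (induction bs arbitrary: A) (auto simp: Un_assoc)

lemma seg_inv_insert:
  assumes "\<forall>a\<in>set (concat bs). a < m" "[] \<notin> set bs" "m \<notin> A" "finite A"
  shows "seg_inv (insert m A) bs = seg_inv A bs + length bs"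
  using assms
proof (induction bs arbitrary: A)
  case (Cons b bs)
  have "block_inv (insert m A) (\<lambda>_. True) b = Suc (block_inv A (\<lambda>_. True) b)"
    by (rule block_inv_insert_first) (use Cons.prems in auto)
  moreover have "seg_inv (insert m (A \<union> set b)) bs = seg_inv (A \<union> set b) bs + length bs"
    by (rule Cons.IH) (use Cons.prems in auto)
  ultimately show ?case by simp
qed simp

text \<open>The block is cut at \<open>m\<close> by \<open>block_inv_max\<close>, and each block of
  \<open>rs\<close> then loses the pair of \<open>m\<close> with its first letter. Here
  \<open>xs\<close> and \<open>ys\<close> may be empty, since empty blocks contribute
  nothing.\<close>

lemma seg_inv_max:
  assumes "\<forall>a\<in>A \<union> set (concat (ls @ xs # ys # rs)). a < m" "[] \<notin> set rs" "finite A"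
  shows "seg_inv A (ls @ (xs @ m # ys) # rs) = seg_inv A (ls @ xs # ys # rs) + length rs"
proof -
  let ?B = "A \<union> set (concat ls)"
  have "block_inv ?B (\<lambda>_. True) (xs @ m # ys)
    = block_inv ?B (\<lambda>_. True) xs + block_inv (?B \<union> set xs) (\<lambda>_. True) ys"
    by (rule block_inv_max) (use assms in auto)
  moreover have "seg_inv (insert m (?B \<union> set xs \<union> set ys)) rs
      = seg_inv (?B \<union> set xs \<union> set ys) rs + length rs"
    by (rule seg_inv_insert) (use assms in auto)
  ultimately show ?thesis by (simp add: seg_inv_append Un_assoc)
qed

lemma seg_adj_max:
  "seg_adj R (ls @ (xs @ m # ys) # rs) = seg_adj R (ls @ xs # ys # rs)
     + of_bool (xs \<noteq> [] \<and> R (last xs) m) + of_bool (ys \<noteq> [] \<and> R m (hd ys))"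
  by (simp add: adj_append[of R xs m ys] adj_Cons[of R m])

section \<open>Ascents, descents and sminversions by recursion on blocks\<close>

lemma letter_append:
  "1 \<le> i \<Longrightarrow> i \<le> length (concat bs) \<Longrightarrow> letter (bs @ cs) i = letter bs i"
  by (auto simp: letter_def nth_append)

lemma letter_append_last:
  "letter (bs @ [b]) (Suc (length (concat bs) + j)) = b ! j" if "j < length b"
  by (simp add: letter_def nth_append)

lemma letter_in:
  "1 \<le> i \<Longrightarrow> i \<le> length (concat bs) \<Longrightarrow> letter bs i \<in> set (concat bs)"
  unfolding letter_def by (rule nth_mem) auto

text \<open>A pair of adjacent positions lies in the old blocks, inside \<open>b\<close>, or across
  the boundary. Distinctness keeps the letters of \<open>b\<close> out of the old blocks, so a pair
  across the boundary shares no block and no old pair is affected by \<open>b\<close>.\<close>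

lemma rel_positions_snoc:
  fixes R :: "nat \<Rightarrow> nat \<Rightarrow> bool"
  defines "rel bs \<equiv> {i. 1 \<le> i \<and> i < length (concat bs) \<and>
     same_block bs i (i + 1) \<and> R (letter bs i) (letter bs (i + 1))}"
  assumes d: "distinct (concat (bs @ [b]))"
  shows "rel (bs @ [b]) = rel bs \<union>
    (\<lambda>j. Suc (length (concat bs) + j)) ` {j. Suc j < length b \<and> R (b ! j) (b ! Suc j)}"
proof (intro set_eqI)
  fix i
  let ?l = "length (concat bs)"
  consider "i < 1" | "1 \<le> i" "i < ?l" | "1 \<le> i" "i = ?l" | j where "Suc j < length b" "i = Suc (?l + j)"
    | "i \<ge> ?l + length b"
  proof -
    have "\<exists>j. Suc j < length b \<and> i = Suc (?l + j)" if "?l < i" "i < ?l + length b"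
      using that by (intro exI[of _ "i - Suc ?l"]) auto
    then show ?thesis using that by (meson linorder_neqE_nat linorder_not_le)
  qed
  then show "i \<in> rel (bs @ [b]) \<longleftrightarrow> i \<in> rel bs \<union>
    (\<lambda>j. Suc (length (concat bs) + j)) ` {j. Suc j < length b \<and> R (b ! j) (b ! Suc j)}"
  proof cases
    case 2
    have "letter bs i \<in> set (concat bs)" using 2 by (intro letter_in) auto
    then have "same_block (bs @ [b]) i (i + 1) = same_block bs i (i + 1)"
      using d 2 letter_append[of i bs "[b]"] letter_append[of "i+1" bs "[b]"]
      unfolding same_block_def by auto
    then show ?thesis
      using 2 letter_append[of i bs "[b]"] letter_append[of "i+1" bs "[b]"]
      unfolding rel_def by auto
  next
    case 3
    have a: "letter bs i \<in> set (concat bs)" using 3 by (intro letter_in) auto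
    have "\<not> same_block (bs @ [b]) i (i + 1)" if "b \<noteq> []"
    proof -
      have "letter (bs @ [b]) (i + 1) \<in> set b" 
        using letter_append_last[of 0 b bs] 3 that by simp
      then show ?thesis
        using a d 3 letter_append[of i bs "[b]"] unfolding same_block_def by auto
    qed
    then show ?thesis using 3 unfolding rel_def by (cases "b = []") auto
  next
    case (4 j)
    then show ?thesis
      using letter_append_last[of j b bs] letter_append_last[of "Suc j" b bs]
      unfolding rel_def same_block_def by (auto intro: bexI[of _ b])
  qed (auto simp: rel_def)
qed

lemma card_adj: "card {j. Suc j < length b \<and> R (b ! j) (b ! Suc j)} = adj R b"
proof (induction R b rule: adj.induct)
  case (1 R a b xs)
  let ?S = "\<lambda>c. {j. Suc j < length c \<and> R (c ! j) (c ! Suc j)}"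
  have "?S (a # b # xs) = (if R a b then {0} else {}) \<union> Suc ` ?S (b # xs)"
    by (auto simp: image_iff less_Suc_eq_0_disj)
  moreover have "finite (?S (b # xs))" by (rule finite_subset[of _ "{..length (b#xs)}"]) auto
  ultimately show ?case using 1 by (auto simp: card_image card_insert_if)
qed auto

lemma card_rel_positions:
  fixes R :: "nat \<Rightarrow> nat \<Rightarrow> bool"
  assumes "distinct (concat bs)"
  shows "card {i. 1 \<le> i \<and> i < length (concat bs) \<and>
     same_block bs i (i + 1) \<and> R (letter bs i) (letter bs (i + 1))} = seg_adj R bs"
  using assms
proof (induction bs rule: rev_induct)
  case (snoc b bs)
  let ?S = "{j. Suc j < length b \<and> R (b ! j) (b ! Suc j)}"
  let ?r = "\<lambda>bs. {i. 1 \<le> i \<and> i < length (concat bs) \<and>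
     same_block bs i (i + 1) \<and> R (letter bs i) (letter bs (i + 1))}"
  have f: "finite ?S" by (rule finite_subset[of _ "{..length b}"]) auto
  have "card (?r (bs @ [b])) = card (?r bs) + card ((\<lambda>j. Suc (length (concat bs) + j)) ` ?S)"
    unfolding rel_positions_snoc[OF snoc.prems] 
    by (intro card_Un_disjoint) (auto intro: f simp: finite_subset[of _ "{..length (concat bs)}"])
  then show ?case using snoc by (simp add: card_image inj_on_def card_adj)
qed simp

lemma card_ascents: "distinct (concat bs) \<Longrightarrow> card (ascents bs) = seg_adj (<) bs"
  unfolding ascents_def by (rule card_rel_positions)

lemma card_descents: "distinct (concat bs) \<Longrightarrow> card (descents bs) = seg_adj (>) bs"
  unfolding descents_def by (rule card_rel_positions)

text \<open>The side condition of a sminversion concerns the position of its right end. Grouping by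
  right end therefore matches the order in which \<open>block_inv\<close> counts.\<close>

definition inv_at :: "nat list list \<Rightarrow> nat \<Rightarrow> nat set" where
  "inv_at bs j = {i. 1 \<le> i \<and> i < j \<and> letter bs i > letter bs j \<and>
     (first_in_block bs j \<or> letter bs (j - 1) > letter bs i)}"

lemma sminv_eq_sum: "sminv bs = (\<Sum>j = 1..length (concat bs). card (inv_at bs j))"
proof -
  have "sminversions bs = prod.swap ` (SIGMA j:{1..length (concat bs)}. inv_at bs j)"
    unfolding sminversions_def inv_at_def by (auto simp: image_iff)
  moreover have "finite (inv_at bs j)" for j
    by (rule finite_subset[of _ "{..j}"]) (auto simp: inv_at_def)
  ultimately show ?thesis by (simp add: sminv_def card_image)
qed

text \<open>As the letters are distinct, left ends may be counted by their letters. This replaces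
  positions by the set of letters read so far, as in \<open>block_inv\<close>.\<close>

lemma card_inv_at_last:
  assumes d: "distinct (concat (bs @ [b]))" and n: "[] \<notin> set (bs @ [b])" and j: "j < length b"
  shows "card (inv_at (bs @ [b]) (Suc (length (concat bs) + j))) =
    card {a \<in> set (concat bs) \<union> set (take j b). b ! j < a \<and> (j = 0 \<or> a < b ! (j - 1))}"
proof -
  let ?c = "concat (bs @ [b])" and ?k = "length (concat bs) + j"
  \<comment> \<open>\<open>hd []\<close> is unspecified and could coincide with
    \<open>b ! j\<close>. Since all blocks are nonempty, \<open>hd c\<close> is a letter of
    \<open>c\<close>, and distinctness gives \<open>c = b\<close>.\<close>
  have first: "first_in_block (bs @ [b]) (Suc ?k) \<longleftrightarrow> j = 0"
  proof
    assume "first_in_block (bs @ [b]) (Suc ?k)"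
    then obtain c where c: "c \<in> set (bs @ [b])" "b ! j = hd c"
      using letter_append_last[OF j] unfolding first_in_block_def by auto
    have "b ! j \<in> set b" using j by simp
    moreover have "hd c \<in> set c" using c n by (metis hd_in_set)
    ultimately have "c = b" using c d by auto
    then have "b ! j = b ! 0" using c j by (cases b) auto
    then show "j = 0" using d j nth_eq_iff_index_eq[of b j 0] by (cases "b = []") auto
  next
    assume "j = 0"
    then show "first_in_block (bs @ [b]) (Suc ?k)"
      using letter_append_last[OF j] j unfolding first_in_block_def by (auto simp: hd_conv_nth)
  qed
  have lk: "letter (bs @ [b]) (Suc ?k) = b ! j" using letter_append_last[OF j] .
  have lk': "letter (bs @ [b]) ?k = b ! (j - 1)" if "j > 0"
    using letter_append_last[of "j - 1" b bs] j that by auto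
  have tk: "set (concat bs) \<union> set (take j b) = set (take ?k ?c)" by simp
  have "bij_betw (\<lambda>i. ?c ! (i - 1)) (inv_at (bs @ [b]) (Suc ?k))
     {a \<in> set (concat bs) \<union> set (take j b). b ! j < a \<and> (j = 0 \<or> a < b ! (j - 1))}"
    unfolding bij_betw_def
  proof
    show "inj_on (\<lambda>i. ?c ! (i - 1)) (inv_at (bs @ [b]) (Suc ?k))"
    proof (rule inj_onI)
      fix x y assume "x \<in> inv_at (bs @ [b]) (Suc ?k)" "y \<in> inv_at (bs @ [b]) (Suc ?k)"
        and e: "?c ! (x - 1) = ?c ! (y - 1)"
      then have *: "1 \<le> x" "1 \<le> y" "x - 1 < length ?c" "y - 1 < length ?c"
        using j by (auto simp: inv_at_def)
      then have "x - 1 = y - 1" using e d nth_eq_iff_index_eq by blast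
      then show "x = y" using * by simp
    qed
    show "(\<lambda>i. ?c ! (i - 1)) ` inv_at (bs @ [b]) (Suc ?k) =
      {a \<in> set (concat bs) \<union> set (take j b). b ! j < a \<and> (j = 0 \<or> a < b ! (j - 1))}" (is "?L = ?R")
    proof
      show "?L \<subseteq> ?R"
      proof
        fix a assume "a \<in> ?L"
        then obtain i where i: "a = ?c ! (i - 1)" "i \<in> inv_at (bs @ [b]) (Suc ?k)" by auto
        have "a = take ?k ?c ! (i - 1)" using i nth_take[of "i - 1" ?k ?c] by (auto simp: inv_at_def simp del: take_append concat_append)
        moreover have "i - 1 < length (take ?k ?c)" using i j by (auto simp: inv_at_def)
        ultimately have "a \<in> set (take ?k ?c)" by (metis nth_mem)
        moreover have "b ! j < a" "j = 0 \<or> a < b ! (j - 1)"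
          using i(2) lk lk' first unfolding inv_at_def i(1) by (auto simp: letter_def)
        ultimately show "a \<in> ?R" unfolding tk by blast
      qed
      show "?R \<subseteq> ?L"
      proof
        fix a assume a: "a \<in> ?R"
        then have "a \<in> set (take ?k ?c)" unfolding tk by blast
        then obtain i where i: "i < ?k" "a = ?c ! i"
          by (metis in_set_conv_nth length_take min_less_iff_conj nth_take)
        then have "Suc i \<in> inv_at (bs @ [b]) (Suc ?k)"
          using a lk lk' first unfolding inv_at_def by (auto simp: letter_def)
        then show "a \<in> ?L" using i by (intro image_eqI[of _ _ "Suc i"]) auto
      qed
    qed
  qed
  then show ?thesis by (rule bij_betw_same_card)
qed

lemma block_inv_eq_sum:
  "block_inv A P b = (\<Sum>j<length b.
     card {a \<in> A \<union> set (take j b). b ! j < a \<and> (if j = 0 then P a else a < b ! (j - 1))})"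
proof (induction b arbitrary: A P)
  case (Cons x b)
  \<comment> \<open>The tail is read with the condition \<open>a < x\<close>, where \<open>x\<close>
    is the letter preceding its first one. Thus term \<open>j\<close> of the tail is term
    \<open>Suc j\<close> of \<open>x # b\<close>.\<close>
  have "(\<Sum>j<length b. card {a \<in> insert x A \<union> set (take j b). b ! j < a \<and>
          (if j = 0 then a < x else a < b ! (j - 1))})
     = (\<Sum>j<length b. card {a \<in> A \<union> set (take (Suc j) (x # b)). (x # b) ! Suc j < a \<and>
          a < (x # b) ! j})"
    by (intro sum.cong refl arg_cong[where f = card]) (auto simp: nth_Cons split: nat.splits)
  also have "\<dots> = (\<Sum>j<length b. card {a \<in> A \<union> set (take (Suc j) (x # b)). (x # b) ! Suc j < a \<and>
          (if Suc j = 0 then P a else a < (x # b) ! (Suc j - 1))})"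
    by simp
  finally show ?case
    by (simp only: block_inv.simps Cons.IH list.size sum.lessThan_Suc_shift add_Suc_right add_0_right) simp
qed simp

text \<open>Blocks are appended on the right because later blocks do not influence the sminversions
  whose right end lies in an earlier block.\<close>

lemma sminv_eq:
  assumes "distinct (concat bs)" "[] \<notin> set bs"
  shows "sminv bs = seg_inv {} bs"
  using assms
proof (induction bs rule: rev_induct)
  case (snoc b bs)
  let ?l = "length (concat bs)"
  have "inv_at (bs @ [b]) j = inv_at bs j" if j: "j \<in> {1..?l}" for j
  proof -
    have l: "letter (bs @ [b]) i = letter bs i" if "1 \<le> i" "i \<le> j" for i
      using that j by (intro letter_append) auto
    have "letter bs j \<in> set (concat bs)" using j by (intro letter_in) auto
    \<comment> \<open>The new block brings in a new first letter, which differs from every old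
      letter. So no old position becomes first in its block.\<close>
    then have "letter bs j \<noteq> hd b" using snoc.prems by (cases b) auto
    then have "first_in_block (bs @ [b]) j = first_in_block bs j"
      using l[of j] j unfolding first_in_block_def by auto
    then show ?thesis using l j unfolding inv_at_def by auto
  qed
  then have old: "(\<Sum>j = 1..?l. card (inv_at (bs @ [b]) j)) = sminv bs"
    by (simp add: sminv_eq_sum)
  have "sminv (bs @ [b]) = (\<Sum>j = 1..?l + length b. card (inv_at (bs @ [b]) j))"
    by (simp add: sminv_eq_sum)
  also have "\<dots> = sminv bs + (\<Sum>j = Suc ?l..<Suc ?l + length b. card (inv_at (bs @ [b]) j))"
    unfolding old[symmetric]
    by (subst sum.ub_add_nat) (auto simp: atLeastLessThanSuc_atLeastAtMost)
  also have "(\<Sum>j = Suc ?l..<Suc ?l + length b. card (inv_at (bs @ [b]) j)) =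
     (\<Sum>j<length b. card (inv_at (bs @ [b]) (Suc (?l + j))))"
    by (rule sum.reindex_bij_witness[of _ "\<lambda>j. Suc (?l + j)" "\<lambda>j. j - Suc ?l"]) auto
  also have "\<dots> = block_inv (set (concat bs)) (\<lambda>_. True) b"
    unfolding block_inv_eq_sum
    by (intro sum.cong refl, subst card_inv_at_last[OF snoc.prems])
      (auto intro!: arg_cong[where f = card])
  finally show ?case using snoc by (simp add: seg_inv_append)
qed (simp add: sminv_eq_sum)

section \<open>Inserting the largest letter\<close>

definition seg_perms :: "nat \<Rightarrow> nat \<Rightarrow> nat list list set" where
  "seg_perms n r = {bs. segmented_perm n bs \<and> length bs = r}"

definition seg_weight :: "'a::comm_semiring_1 \<Rightarrow> 'a \<Rightarrow> 'a \<Rightarrow> nat list list \<Rightarrow> 'a" where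
  "seg_weight q u v bs = u ^ seg_adj (<) bs * v ^ seg_adj (>) bs * q ^ seg_inv {} bs"

text \<open>This is \<open>F n r\<close> of the recurrence for segmented permutations;
  \<open>path_sum\<close> is its counterpart for paths.\<close>

definition seg_sum :: "'a::comm_semiring_1 \<Rightarrow> 'a \<Rightarrow> 'a \<Rightarrow> nat \<Rightarrow> nat \<Rightarrow> 'a" where
  "seg_sum q u v n r = (\<Sum>bs\<in>seg_perms n r. seg_weight q u v bs)"

lemma length_le_length_concat: "[] \<notin> set bs \<Longrightarrow> length bs \<le> length (concat bs)"
proof (induction bs)
  case (Cons b bs)
  then have "length b > 0" by auto
  with Cons show ?case by (simp add: add_mono Suc_le_eq add_less_le_mono[of 0 "length b" "length bs", simplified])
qed simp

lemma segmented_perm_length: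
  "segmented_perm n bs \<Longrightarrow> length (concat bs) = n"
  unfolding segmented_perm_def by (metis card_atLeastAtMost diff_Suc_1 distinct_card)

lemma finite_segmented_perm: "finite {bs. segmented_perm n bs}"
proof (rule finite_subset)
  show "{bs. segmented_perm n bs} \<subseteq>
    {bs. set bs \<subseteq> {b. set b \<subseteq> {1..n} \<and> length b \<le> n} \<and> length bs \<le> n}"
  proof clarify
    fix bs assume s: "segmented_perm n bs"
    have "set b \<subseteq> {1..n} \<and> length b \<le> n" if "b \<in> set bs" for b
    proof -
      have "set b \<subseteq> {1..n}" "distinct b"
        using s that unfolding segmented_perm_def by (auto simp: distinct_concat_iff)
      then show ?thesis using card_mono[of "{1..n}" "set b"] by (simp add: distinct_card)
    qed
    moreover have "length bs \<le> n"
      using length_le_length_concat[of bs] segmented_perm_length[OF s] s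
      unfolding segmented_perm_def by simp
    ultimately show "set bs \<subseteq> {b. set b \<subseteq> {1..n} \<and> length b \<le> n} \<and> length bs \<le> n" by auto
  qed
  show "finite {bs. set bs \<subseteq> {b. set b \<subseteq> {1..n} \<and> length b \<le> n} \<and> length bs \<le> n}"
    by (intro finite_lists_length_le) simp
qed

lemma finite_seg_perms [simp]: "finite (seg_perms n r)"
  by (rule finite_subset[OF _ finite_segmented_perm]) (auto simp: seg_perms_def)

text \<open>Deleting the largest letter from \<open>xs @ m # ys\<close> leaves \<open>xs\<close> and
  \<open>ys\<close>, either of which may be empty. Dropping empty lists covers the four cases by one
  expression.\<close>

definition nonempties :: "nat list list \<Rightarrow> nat list list" where
  "nonempties bs = filter (\<lambda>b. b \<noteq> []) bs"

lemma nonempties_simps [simp]: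
  "nonempties [] = []" "nonempties (b # bs) = (if b = [] then nonempties bs else b # nonempties bs)"
  "nonempties (bs @ cs) = nonempties bs @ nonempties cs"
  by (simp_all add: nonempties_def)

lemma concat_nonempties: "concat (nonempties bs) = concat bs"
  by (induction bs) auto

lemma Nil_notin_nonempties: "[] \<notin> set (nonempties bs)"
  by (simp add: nonempties_def)

lemma nonempties_id: "[] \<notin> set bs \<Longrightarrow> nonempties bs = bs"
  by (induction bs) auto

lemma seg_adj_nonempties: "seg_adj R (nonempties bs) = seg_adj R bs"
  by (induction bs) auto

lemma seg_inv_nonempties: "seg_inv A (nonempties bs) = seg_inv A bs"
  by (induction bs arbitrary: A) auto

text \<open>Both sides reduce to conditions on \<open>?dist\<close> and on the set \<open>?B\<close>
  of the other letters. They agree because \<open>Suc n\<close> cancels from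
  \<open>insert (Suc n) ?B = {1..Suc n}\<close> when it is not in \<open>?B\<close>.\<close>

lemma segmented_perm_insert:
  "segmented_perm (Suc n) (ls @ (xs @ Suc n # ys) # rs) \<longleftrightarrow>
   [] \<notin> set ls \<and> [] \<notin> set rs \<and> segmented_perm n (ls @ nonempties [xs, ys] @ rs)"
proof -
  let ?B = "set (concat ls) \<union> set xs \<union> set ys \<union> set (concat rs)"
  let ?dist = "distinct (concat ls @ xs @ ys @ concat rs)"
  have "insert (Suc n) ?B = {1..Suc n} \<longleftrightarrow> ?B = {1..n}" if "Suc n \<notin> ?B"
    using that insert_ident[of "Suc n" ?B "{1..n}"] by (simp add: atLeastAtMostSuc_conv)
  moreover have "Suc n \<notin> ?B" if "?B = {1..n}"
    unfolding that by simp
  moreover have "segmented_perm (Suc n) (ls @ (xs @ Suc n # ys) # rs) \<longleftrightarrow>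
      [] \<notin> set ls \<and> [] \<notin> set rs \<and> ?dist \<and> Suc n \<notin> ?B \<and> insert (Suc n) ?B = {1..Suc n}"
    unfolding segmented_perm_def by (auto simp del: atLeastAtMost_iff)
  moreover have "segmented_perm n (ls @ nonempties [xs, ys] @ rs) \<longleftrightarrow>
      [] \<notin> set ls \<and> [] \<notin> set rs \<and> ?dist \<and> ?B = {1..n}"
    unfolding segmented_perm_def
    by (simp add: concat_nonempties Nil_notin_nonempties Un_assoc del: nonempties_simps)
  ultimately show ?thesis by blast
qed

text \<open>A tuple records what is left of the blocks before, inside (on both sides) and after the
  letter \<open>Suc n\<close> when this letter is deleted; \<open>r\<close> is the number of blocks before the deletion.\<close>

definition splits :: "nat \<Rightarrow> nat \<Rightarrow> (nat list list \<times> nat list \<times> nat list \<times> nat list list) set" where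
  "splits n r = {(ls, xs, ys, rs). [] \<notin> set ls \<and> [] \<notin> set rs \<and> Suc (length ls + length rs) = r \<and>
     segmented_perm n (ls @ nonempties [xs, ys] @ rs)}"

text \<open>The letter \<open>Suc n\<close> occurs exactly once, so its block and its place in that
  block are determined.\<close>

lemma bij_betw_splits:
  "bij_betw (\<lambda>(ls, xs, ys, rs). ls @ (xs @ Suc n # ys) # rs) (splits n r) (seg_perms (Suc n) r)"
  (is "bij_betw ?f _ _")
  unfolding bij_betw_def
proof
  show "inj_on ?f (splits n r)"
  proof (rule inj_onI)
    fix d d' assume dd: "d \<in> splits n r" "d' \<in> splits n r" "?f d = ?f d'"
    obtain ls xs ys rs where d: "d = (ls, xs, ys, rs)" by (cases d)
    obtain ls' xs' ys' rs' where d': "d' = (ls', xs', ys', rs')" by (cases d')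
    have s: "(ls, xs, ys, rs) \<in> splits n r" "(ls', xs', ys', rs') \<in> splits n r"
      and e: "ls @ (xs @ Suc n # ys) # rs = ls' @ (xs' @ Suc n # ys') # rs'"
      using dd by (simp_all add: d d')
    have notin: "Suc n \<notin> set (concat ls) \<union> set xs \<union> set ys \<union> set (concat rs)"
      if "(ls, xs, ys, rs) \<in> splits n r" for ls xs ys rs
    proof -
      have "set (concat ls) \<union> set xs \<union> set ys \<union> set (concat rs) = {1..n}"
        using that unfolding splits_def segmented_perm_def by (auto simp: concat_nonempties simp del: nonempties_simps)
      then show ?thesis by simp
    qed
    \<comment> \<open>If the two factorizations cut at different places, the excess
      \<open>us\<close> starts with the block that contains \<open>Suc n\<close>. This block would
      then belong to \<open>ls\<close> or \<open>ls'\<close>, against \<open>notin\<close>. The same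
      argument with letters gives \<open>xs = xs'\<close>.\<close>
    have "ls = ls' \<and> xs @ Suc n # ys = xs' @ Suc n # ys' \<and> rs = rs'"
    proof -
      obtain us where "ls = ls' @ us \<and> us @ (xs @ Suc n # ys) # rs = (xs' @ Suc n # ys') # rs' \<or>
         ls @ us = ls' \<and> (xs @ Suc n # ys) # rs = us @ (xs' @ Suc n # ys') # rs'"
        using e unfolding append_eq_append_conv2 by blast
      then show ?thesis using notin[OF s(1)] notin[OF s(2)] by (cases us) auto
    qed
    moreover from this have "xs = xs' \<and> ys = ys'"
    proof -
      obtain us where "xs = xs' @ us \<and> us @ Suc n # ys = Suc n # ys' \<or>
         xs @ us = xs' \<and> Suc n # ys = us @ Suc n # ys'"
        using calculation unfolding append_eq_append_conv2 by blast
      then show ?thesis using notin[OF s(1)] notin[OF s(2)] by (cases us) auto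
    qed
    ultimately show "d = d'" by (simp add: d d')
  qed
  show "?f ` splits n r = seg_perms (Suc n) r"
  proof
    show "?f ` splits n r \<subseteq> seg_perms (Suc n) r"
      by (auto simp: splits_def seg_perms_def segmented_perm_insert)
    show "seg_perms (Suc n) r \<subseteq> ?f ` splits n r"
    proof
      fix bs assume bs: "bs \<in> seg_perms (Suc n) r"
      then have "Suc n \<in> set (concat bs)" by (auto simp: seg_perms_def segmented_perm_def)
      then obtain b where "b \<in> set bs" "Suc n \<in> set b" by auto
      then obtain ls xs ys rs where "bs = ls @ (xs @ Suc n # ys) # rs"
        by (metis split_list)
      with bs show "bs \<in> ?f ` splits n r"
        by (intro image_eqI[of _ _ "(ls, xs, ys, rs)"])
          (auto simp: splits_def seg_perms_def segmented_perm_insert)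
    qed
  qed
qed

lemma seg_weight_insert:
  assumes "(ls, xs, ys, rs) \<in> splits n r"
  shows "seg_weight q u v (ls @ (xs @ Suc n # ys) # rs) =
     (if xs = [] then 1 else u) * (if ys = [] then 1 else v) * q ^ length rs *
     seg_weight q u v (ls @ nonempties [xs, ys] @ rs)"
proof -
  have B: "set (concat (ls @ xs # ys # rs)) = {1..n}"
    using assms unfolding splits_def segmented_perm_def by (auto simp: concat_nonempties simp del: nonempties_simps)
  have lt: "a < Suc n" if "a \<in> set xs \<union> set ys" for a
  proof -
    have "a \<in> {1..n}" using that unfolding B[symmetric] by auto
    then show ?thesis by simp
  qed
  have rs: "[] \<notin> set ls" "[] \<notin> set rs" using assms by (auto simp: splits_def)
  have f: "ls @ nonempties [xs, ys] @ rs = nonempties (ls @ xs # ys # rs)"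
    using rs by (simp add: nonempties_id)
  have "seg_inv {} (ls @ (xs @ Suc n # ys) # rs) = seg_inv {} (ls @ xs # ys # rs) + length rs"
    by (rule seg_inv_max) (use rs in \<open>simp_all only: B, auto\<close>)
  moreover have "seg_adj (<) (ls @ (xs @ Suc n # ys) # rs) =
      seg_adj (<) (ls @ xs # ys # rs) + of_bool (xs \<noteq> [])"
    unfolding seg_adj_max using lt[of "last xs"] lt[of "hd ys"] by auto
  moreover have "seg_adj (>) (ls @ (xs @ Suc n # ys) # rs) =
      seg_adj (>) (ls @ xs # ys # rs) + of_bool (ys \<noteq> [])"
    unfolding seg_adj_max using lt[of "last xs"] lt[of "hd ys"] by auto
  ultimately show ?thesis
    unfolding seg_weight_def f seg_adj_nonempties seg_inv_nonempties
    by (simp only: power_add) (simp add: ac_simps)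
qed

section \<open>The recurrence for segmented permutations\<close>

lemma q_int_eq: "q_int q (int r) = (\<Sum>j<r. q ^ j)"
  by (simp add: q_int_def)

text \<open>The map \<open>h\<close> sends \<open>d\<close> to the number of blocks before the
  deleted letter and to the remaining blocks; \<open>l d\<close> counts the blocks after it. Each
  position \<open>s < r\<close> occurs with every element of \<open>S\<close>, and the powers
  \<open>q ^ (r - Suc s)\<close> add up to the q-integer of \<open>r\<close>.\<close>

lemma sum_positions:
  fixes g :: "nat list list \<Rightarrow> 'a::comm_semiring_1"
  assumes bij: "bij_betw h D ({..<r} \<times> S)" and l: "\<And>d. d \<in> D \<Longrightarrow> Suc (fst (h d) + l d) = r"
  shows "(\<Sum>d\<in>D. q ^ l d * g (snd (h d))) = q_int q (int r) * (\<Sum>bs\<in>S. g bs)"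
proof -
  have "(\<Sum>d\<in>D. q ^ l d * g (snd (h d))) = (\<Sum>d\<in>D. (\<lambda>(s, bs). q ^ (r - Suc s) * g bs) (h d))"
    using l by (intro sum.cong refl) (force simp: case_prod_beta)
  also have "\<dots> = (\<Sum>(s, bs)\<in>{..<r} \<times> S. q ^ (r - Suc s) * g bs)"
    by (rule sum.reindex_bij_betw[OF bij])
  also have "\<dots> = (\<Sum>s<r. q ^ (r - Suc s)) * (\<Sum>bs\<in>S. g bs)"
    by (simp add: sum_product sum.cartesian_product)
  also have "(\<Sum>s<r. q ^ (r - Suc s)) = q_int q (int r)"
    unfolding q_int_eq by (rule sum.nat_diff_reindex)
  finally show ?thesis .
qed

lemma Nil_notin_segmented_perm: "segmented_perm n bs \<Longrightarrow> [] \<notin> set bs"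
  by (simp add: segmented_perm_def)

lemma nth_segmented_perm: "segmented_perm n bs \<Longrightarrow> i < length bs \<Longrightarrow> bs ! i \<noteq> []"
  unfolding segmented_perm_def by (metis nth_mem)

text \<open>The letter was a block of its own: it can be put back into any of the \<open>r\<close>
  gaps around \<open>r - 1\<close> blocks.\<close>

lemma bij_betw_split_at:
  assumes "r > 0"
  shows "bij_betw (\<lambda>(ls, xs, ys, rs). (length ls, ls @ rs))
    {(ls, xs, ys, rs). (ls, xs, ys, rs) \<in> splits n r \<and> xs = [] \<and> ys = []}
    ({..<r} \<times> seg_perms n (r - 1))"
  by (rule bij_betw_byWitness[where f' = "\<lambda>(s, bs). (take s bs, [], [], drop s bs)"])
    (use assms in \<open>auto simp: splits_def seg_perms_def dest: Nil_notin_segmented_perm in_set_takeD in_set_dropD\<close>)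

text \<open>The letter ended its block: it can be put back at the end of any of \<open>r\<close>
  blocks, or at the front in the mirror case \<open>bij_betw_split_right\<close>.\<close>

lemma bij_betw_split_left:
  "bij_betw (\<lambda>(ls, xs, ys, rs). (length ls, ls @ xs # rs))
    {(ls, xs, ys, rs). (ls, xs, ys, rs) \<in> splits n r \<and> xs \<noteq> [] \<and> ys = []}
    ({..<r} \<times> seg_perms n r)"
  by (rule bij_betw_byWitness[where f' = "\<lambda>(s, bs). (take s bs, bs ! s, [], drop (Suc s) bs)"])
    (auto simp: splits_def seg_perms_def id_take_nth_drop[symmetric] nth_append nth_segmented_perm
      dest: Nil_notin_segmented_perm in_set_takeD in_set_dropD)

lemma bij_betw_split_right:
  "bij_betw (\<lambda>(ls, xs, ys, rs). (length ls, ls @ ys # rs))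
    {(ls, xs, ys, rs). (ls, xs, ys, rs) \<in> splits n r \<and> xs = [] \<and> ys \<noteq> []}
    ({..<r} \<times> seg_perms n r)"
  by (rule bij_betw_byWitness[where f' = "\<lambda>(s, bs). (take s bs, [], bs ! s, drop (Suc s) bs)"])
    (auto simp: splits_def seg_perms_def id_take_nth_drop[symmetric] nth_append nth_segmented_perm
      dest: Nil_notin_segmented_perm in_set_takeD in_set_dropD)

text \<open>The letter was inside its block: putting it back glues blocks \<open>s\<close> and
  \<open>Suc s\<close> of \<open>Suc r\<close> blocks, with \<open>r\<close> choices for
  \<open>s\<close>.\<close>

lemma bij_betw_split_both:
  "bij_betw (\<lambda>(ls, xs, ys, rs). (length ls, ls @ xs # ys # rs))
    {(ls, xs, ys, rs). (ls, xs, ys, rs) \<in> splits n r \<and> xs \<noteq> [] \<and> ys \<noteq> []}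
    ({..<r} \<times> seg_perms n (Suc r))"
  by (rule bij_betw_byWitness[where f' = "\<lambda>(s, bs). (take s bs, bs ! s, bs ! Suc s, drop (Suc (Suc s)) bs)"])
    (auto simp: splits_def seg_perms_def id_take_nth_drop[symmetric] nth_append nth_segmented_perm Cons_nth_drop_Suc
      dest: Nil_notin_segmented_perm in_set_takeD in_set_dropD)

lemma finite_splits: "finite (splits n r)"
  using bij_betw_finite[OF bij_betw_splits] by simp

lemma seg_sum_Suc:
  assumes "r > 0"
  shows "seg_sum q u v (Suc n) r = q_int q (int r) *
    (seg_sum q u v n (r - 1) + (u + v) * seg_sum q u v n r + u * v * seg_sum q u v n (Suc r))"
proof -
  let ?w = "\<lambda>(ls, xs, ys, rs). (if xs = [] then 1 else u) * (if ys = [] then 1 else v) * q ^ length rs *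
     seg_weight q u v (ls @ nonempties [xs, ys] @ rs)"
  \<comment> \<open>The flags say whether \<open>xs\<close> and \<open>ys\<close> are empty. The
    four classes carry the factors 1, \<open>u\<close>, \<open>v\<close> and
    \<open>u * v\<close>.\<close>
  let ?D = "\<lambda>a b. {(ls, xs, ys, rs). (ls, xs, ys, rs) \<in> splits n r \<and> (xs = []) = a \<and> (ys = []) = b}"
  have "seg_sum q u v (Suc n) r = (\<Sum>d\<in>splits n r. ?w d)"
    unfolding seg_sum_def sum.reindex_bij_betw[OF bij_betw_splits, symmetric]
    by (intro sum.cong refl) (auto simp: seg_weight_insert)
  also have "splits n r = (?D True True \<union> ?D False True) \<union> (?D True False \<union> ?D False False)"
    by auto
  also have "(\<Sum>d\<in>\<dots>. ?w d) = (\<Sum>d\<in>?D True True. ?w d) + (\<Sum>d\<in>?D False True. ?w d) +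
      ((\<Sum>d\<in>?D True False. ?w d) + (\<Sum>d\<in>?D False False. ?w d))"
    by (subst sum.union_disjoint; (subst sum.union_disjoint)?; (subst sum.union_disjoint)?)
      (auto simp: add_ac intro!: finite_subset[OF _ finite_splits[of n r]])
  also have "(\<Sum>d\<in>?D True True. ?w d) = q_int q (int r) * seg_sum q u v n (r - 1)"
    unfolding seg_sum_def
    by (subst sum_positions[OF bij_betw_split_at[OF assms], where l = "\<lambda>(ls, xs, ys, rs). length rs", symmetric])
      (auto simp: splits_def intro!: sum.cong)
  also have "(\<Sum>d\<in>?D False True. ?w d) = q_int q (int r) * (\<Sum>bs\<in>seg_perms n r. u * seg_weight q u v bs)"
    by (subst sum_positions[OF bij_betw_split_left, where l = "\<lambda>(ls, xs, ys, rs). length rs", symmetric])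
      (auto simp: splits_def mult_ac intro!: sum.cong)
  also have "(\<Sum>d\<in>?D True False. ?w d) = q_int q (int r) * (\<Sum>bs\<in>seg_perms n r. v * seg_weight q u v bs)"
    by (subst sum_positions[OF bij_betw_split_right, where l = "\<lambda>(ls, xs, ys, rs). length rs", symmetric])
      (auto simp: splits_def mult_ac intro!: sum.cong)
  also have "(\<Sum>d\<in>?D False False. ?w d) =
      q_int q (int r) * (\<Sum>bs\<in>seg_perms n (Suc r). u * v * seg_weight q u v bs)"
    by (subst sum_positions[OF bij_betw_split_both, where l = "\<lambda>(ls, xs, ys, rs). length rs", symmetric])
      (auto simp: splits_def mult_ac intro!: sum.cong)
  finally show ?thesis
    by (simp add: sum_distrib_left[symmetric] seg_sum_def algebra_simps)
qed

section \<open>Appending a step to a path\<close>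

lemma path_y_append: "i \<le> length p \<Longrightarrow> path_y (p @ ss) i = path_y p i"
  by (simp add: path_y_def)

lemma path_y_Suc:
  "i < length p \<Longrightarrow> path_y p (Suc i) = path_y p i + snd (step_vector (p ! i))"
  by (simp add: path_y_def take_Suc_conv_app_nth)

text \<open>A step rises by 1 minus its number of decorations, which is also the increment of
  \<open>alpha\<close>. The shift by 1 comes from the first up-step, where \<open>alpha\<close> is 0
  and the height is 1.\<close>

lemma alpha_eq_path_y:
  assumes "p \<noteq> []" "hd p = Up" "i < length p"
  shows "alpha (theta_set p) (xi_set p) (Suc i) = path_y p (Suc i) - 1"
  using assms(3)
proof (induction i)
  case 0
  then show ?case using assms by (simp add: path_y_Suc hd_conv_nth path_y_def[of _ 0])
next
  case (Suc i)
  then show ?case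
    by (cases "p ! Suc i") (auto simp: path_y_Suc[of "Suc i"] theta_set_def xi_set_def)
qed

lemma stair_eq:
  assumes "p \<noteq> []" "hd p = Up"
  shows "stair q p = (\<Prod>i=1..length p. q_int q (path_y p i))"
  unfolding stair_def
proof (intro prod.cong refl)
  fix i assume i: "i \<in> {1..length p}"
  then obtain j where "i = Suc j" "j < length p" by (cases i) auto
  then show "q_int q (alpha (theta_set p) (xi_set p) i + 1) = q_int q (path_y p i)"
    using alpha_eq_path_y[OF assms] by simp
qed

definition path_weight :: "'a::comm_semiring_1 \<Rightarrow> 'a \<Rightarrow> 'a \<Rightarrow> step list \<Rightarrow> 'a" where
  "path_weight q u v p = u ^ deg_theta p * v ^ deg_xi p * stair q p"

fun step_weight :: "'a::comm_semiring_1 \<Rightarrow> 'a \<Rightarrow> step \<Rightarrow> 'a" where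
  "step_weight u v Up = 1"
| "step_weight u v Hor_theta = u"
| "step_weight u v Hor_xi = v"
| "step_weight u v Down_theta_xi = u * v"

text \<open>The sets are unfolded and \<open>c\<close> is arbitrary, so that one equation rewrites
  both degrees.\<close>

lemma card_decoration_snoc:
  "card {i. 1 \<le> i \<and> i \<le> length (p @ [s]) \<and> c \<in> decoration ((p @ [s]) ! (i - 1))} =
   card {i. 1 \<le> i \<and> i \<le> length p \<and> c \<in> decoration (p ! (i - 1))} + of_bool (c \<in> decoration s)"
proof -
  let ?S = "{i. 1 \<le> i \<and> i \<le> length p \<and> c \<in> decoration (p ! (i - 1))}"
  have "{i. 1 \<le> i \<and> i \<le> length (p @ [s]) \<and> c \<in> decoration ((p @ [s]) ! (i - 1))} =
    (if c \<in> decoration s then insert (Suc (length p)) ?S else ?S)"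
    by (auto simp: nth_append le_Suc_eq split: if_splits)
  moreover have "finite ?S" by (rule finite_subset[of _ "{..length p}"]) auto
  ultimately show ?thesis by simp
qed

lemma path_weight_snoc:
  assumes "p \<noteq> []" "hd p = Up"
  shows "path_weight q u v (p @ [s]) = path_weight q u v p * step_weight u v s *
    q_int q (path_y p (length p) + snd (step_vector s))"
proof -
  have "stair q (p @ [s]) = stair q p * q_int q (path_y (p @ [s]) (Suc (length p)))"
    using assms by (simp add: stair_eq path_y_append)
  moreover have "path_y (p @ [s]) (Suc (length p)) = path_y p (length p) + snd (step_vector s)"
    by (simp add: path_y_Suc path_y_append nth_append)
  ultimately show ?thesis
    unfolding path_weight_def deg_theta_def deg_xi_def theta_set_def xi_set_def card_decoration_snoc
    by (cases s) (simp_all add: mult_ac)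
qed

definition paths_to :: "nat \<Rightarrow> nat \<Rightarrow> step list set" where
  "paths_to n r = {p \<in> motzkin_paths n. path_y p n = int r}"

definition path_sum :: "'a::comm_semiring_1 \<Rightarrow> 'a \<Rightarrow> 'a \<Rightarrow> nat \<Rightarrow> nat \<Rightarrow> 'a" where
  "path_sum q u v n r = (\<Sum>p\<in>paths_to n r. path_weight q u v p)"

lemma finite_motzkin_paths: "finite (motzkin_paths n)"
proof (rule finite_subset)
  have "UNIV = {Up, Hor_theta, Hor_xi, Down_theta_xi}"
    using step.exhaust by blast
  then have "finite (UNIV :: step set)" by (metis finite.emptyI finite.insertI)
  then show "finite {p :: step list. set p \<subseteq> UNIV \<and> length p = n}"
    by (rule finite_lists_length_eq)
qed (auto simp: motzkin_paths_def)

lemma finite_paths_to [simp]: "finite (paths_to n r)"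
  using finite_motzkin_paths by (simp add: paths_to_def)

text \<open>As \<open>n > 0\<close>, the first step of \<open>p @ [s]\<close> is that of
  \<open>p\<close>, and only the height of the new endpoint remains to be checked.\<close>

lemma snoc_in_motzkin_paths:
  assumes "n > 0"
  shows "p @ [s] \<in> motzkin_paths (Suc n) \<longleftrightarrow>
    p \<in> motzkin_paths n \<and> path_y p n + snd (step_vector s) \<ge> 1"
proof (cases "length p = n")
  case True
  then have "path_y (p @ [s]) (Suc n) = path_y p n + snd (step_vector s)"
    by (simp add: path_y_Suc path_y_append nth_append)
  moreover have "(\<forall>i\<in>{1..n}. path_y (p @ [s]) i \<ge> 1) \<longleftrightarrow> (\<forall>i\<in>{1..n}. path_y p i \<ge> 1)"
    using True by (intro ball_cong refl) (simp add: path_y_append)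
  moreover have "{1..Suc n} = insert (Suc n) {1..n}"
    by (rule atLeastAtMostSuc_conv) simp
  moreover have "p \<noteq> []" using True assms by auto
  ultimately show ?thesis
    unfolding motzkin_paths_def mem_Collect_eq by (simp only: ball_simps) (use True in auto)
qed (simp add: motzkin_paths_def)

lemma path_y_pos: "n > 0 \<Longrightarrow> p \<in> motzkin_paths n \<Longrightarrow> path_y p n \<ge> 1"
  by (simp add: motzkin_paths_def)

lemma paths_to_0: "n > 0 \<Longrightarrow> paths_to n 0 = {}"
  by (auto simp: paths_to_def dest: path_y_pos)

lemma paths_to_Suc:
  assumes "n > 0" "r > 0"
  shows "paths_to (Suc n) r = (\<lambda>p. p @ [Up]) ` paths_to n (r - 1) \<union>
    ((\<lambda>p. p @ [Hor_theta]) ` paths_to n r \<union> ((\<lambda>p. p @ [Hor_xi]) ` paths_to n r \<union>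
    (\<lambda>p. p @ [Down_theta_xi]) ` paths_to n (Suc r)))" (is "_ = ?R")
proof (intro set_eqI)
  fix p
  show "p \<in> paths_to (Suc n) r \<longleftrightarrow> p \<in> ?R"
  proof (cases p rule: rev_cases)
    case Nil
    then show ?thesis by (auto simp: paths_to_def motzkin_paths_def)
  next
    case (snoc p' s)
    have "p \<in> paths_to (Suc n) r \<longleftrightarrow> p' \<in> motzkin_paths n \<and> path_y p' n + snd (step_vector s) = int r"
    proof -
      have "path_y p (Suc n) = path_y p' n + snd (step_vector s)" if "p' \<in> motzkin_paths n"
        using that snoc by (auto simp: motzkin_paths_def path_y_Suc path_y_append nth_append)
      then show ?thesis
        using assms by (auto simp: paths_to_def snoc snoc_in_motzkin_paths)
    qed
    then show ?thesis
      using assms unfolding snoc by (cases s) (auto simp: paths_to_def image_iff)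
  qed
qed

lemma path_sum_Suc:
  assumes "n > 0" "r > 0"
  shows "path_sum q u v (Suc n) r = q_int q (int r) *
    (path_sum q u v n (r - 1) + (u + v) * path_sum q u v n r + u * v * path_sum q u v n (Suc r))"
proof -
  \<comment> \<open>All four kinds of last step are treated at once; \<open>t\<close> is the height
    before that step.\<close>
  have *: "(\<Sum>p\<in>(\<lambda>p. p @ [s]) ` paths_to n t. path_weight q u v p) =
      q_int q (int r) * (step_weight u v s * path_sum q u v n t)"
    if "int t + snd (step_vector s) = int r" for s t
  proof -
    have "(\<Sum>p\<in>(\<lambda>p. p @ [s]) ` paths_to n t. path_weight q u v p) =
        (\<Sum>p\<in>paths_to n t. path_weight q u v (p @ [s]))"
      by (subst sum.reindex) (auto simp: inj_on_def)
    also have "\<dots> = (\<Sum>p\<in>paths_to n t. q_int q (int r) * (step_weight u v s * path_weight q u v p))"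
      using that by (intro sum.cong refl, subst path_weight_snoc)
        (auto simp: paths_to_def motzkin_paths_def ac_simps)
    finally show ?thesis by (simp add: path_sum_def sum_distrib_left)
  qed
  have "path_sum q u v (Suc n) r =
     (\<Sum>p\<in>(\<lambda>p. p @ [Up]) ` paths_to n (r - 1). path_weight q u v p) +
     ((\<Sum>p\<in>(\<lambda>p. p @ [Hor_theta]) ` paths_to n r. path_weight q u v p) +
     ((\<Sum>p\<in>(\<lambda>p. p @ [Hor_xi]) ` paths_to n r. path_weight q u v p) +
     (\<Sum>p\<in>(\<lambda>p. p @ [Down_theta_xi]) ` paths_to n (Suc r). path_weight q u v p)))"
    unfolding path_sum_def paths_to_Suc[OF assms]
    by (subst sum.union_disjoint; (subst sum.union_disjoint)?; (subst sum.union_disjoint)?) auto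
  moreover have "int (r - 1) + snd (step_vector Up) = int r" using assms by simp
  ultimately show ?thesis
    by (simp only: *[of "r - 1" Up] *[of r Hor_theta] *[of r Hor_xi] *[of "Suc r" Down_theta_xi]
        step_vector.simps snd_conv of_nat_Suc step_weight.simps add_0_right) (simp add: distrib_left distrib_right add_ac)
qed

section \<open>Comparison of the two recurrences\<close>

lemma seg_perms_0: "n > 0 \<Longrightarrow> seg_perms n 0 = {}"
  by (auto simp: seg_perms_def segmented_perm_def)

lemma seg_perms_1: "seg_perms 1 r = (if r = 1 then {[[1]]} else {})"
proof -
  have "bs = [[1]]" if "segmented_perm 1 bs" for bs
  proof -
    have "set (concat bs) = {1}" "length (concat bs) = 1" "[] \<notin> set bs"
      using that segmented_perm_length[OF that] by (auto simp: segmented_perm_def)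
    moreover from this have "length bs \<le> 1"
      using length_le_length_concat[of bs] by simp
    moreover have "bs \<noteq> []" using calculation by auto
    ultimately obtain b where b: "bs = [b]" "set b = {1}" "length b = 1"
      by (cases bs) auto
    then show ?thesis by (cases b) auto
  qed
  moreover have "segmented_perm 1 [[1]]" by (simp add: segmented_perm_def)
  ultimately have eq: "segmented_perm 1 bs \<longleftrightarrow> bs = [[1]]" for bs by blast
  have "seg_perms 1 r = {bs. bs = [[1]] \<and> length bs = r}"
    unfolding seg_perms_def eq ..
  also have "\<dots> = (if r = 1 then {[[1]]} else {})" by auto
  finally show ?thesis .
qed

lemma paths_to_1: "paths_to 1 r = (if r = 1 then {[Up]} else {})"
proof -
  have eq: "p \<in> motzkin_paths 1 \<longleftrightarrow> p = [Up]" for p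
    by (cases p) (auto simp: motzkin_paths_def path_y_def)
  have "paths_to 1 r = {p. p = [Up] \<and> path_y p 1 = int r}"
    unfolding paths_to_def eq ..
  also have "\<dots> = (if r = 1 then {[Up]} else {})" by (auto simp: path_y_def)
  finally show ?thesis .
qed

lemma path_weight_Up: "path_weight q u v [Up] = 1"
proof -
  have "theta_set [Up] = {}" "xi_set [Up] = {}"
    by (auto simp: theta_set_def xi_set_def dest!: le_antisym)
  then show ?thesis by (simp add: path_weight_def deg_theta_def deg_xi_def stair_def q_int_def)
qed

lemma seg_sum_eq_path_sum: "n > 0 \<Longrightarrow> seg_sum q u v n r = path_sum q u v n r"
proof (induction n arbitrary: r rule: nat_induct_non_zero)
  case 1
  show ?case
    unfolding seg_sum_def path_sum_def seg_perms_1 paths_to_1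
    by (simp add: seg_weight_def path_weight_Up)
next
  case (Suc n)
  show ?case
  \<comment> \<open>Both recurrences assume \<open>r > 0\<close>. For \<open>r = 0\<close> both
    index sets are empty.\<close>
  proof (cases "r = 0")
    case True
    then show ?thesis by (simp add: seg_sum_def path_sum_def seg_perms_0 paths_to_0)
  next
    case False
    then show ?thesis using Suc by (simp add: seg_sum_Suc path_sum_Suc)
  qed
qed

section \<open>Sums over all final heights and all numbers of blocks\<close>

lemma path_y_le: "path_y p i \<le> int i"
proof (induction i)
  case (Suc i)
  show ?case
  proof (cases "i < length p")
    case True
    then show ?thesis using Suc by (cases "p ! i") (simp_all add: path_y_Suc)
  next
    case False
    then show ?thesis using Suc by (simp add: path_y_def)
  qed
qed (simp add: path_y_def)

lemma sum_path_weight: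
  assumes "n > 0"
  shows "(\<Sum>p\<in>motzkin_paths n. path_weight q u v p) = (\<Sum>r\<le>n. path_sum q u v n r)"
proof -
  \<comment> \<open>Final heights lie between 1 and \<open>n\<close>, so \<open>nat\<close> loses
    nothing and the classes \<open>r \<le> n\<close> exhaust the paths.\<close>
  have "(\<lambda>p. nat (path_y p n)) ` motzkin_paths n \<subseteq> {..n}"
    using path_y_le by (auto simp: nat_le_iff)
  then have "(\<Sum>p\<in>motzkin_paths n. path_weight q u v p) =
     (\<Sum>r\<le>n. \<Sum>p | p \<in> motzkin_paths n \<and> nat (path_y p n) = r. path_weight q u v p)"
    by (intro sum.group[symmetric] finite_motzkin_paths) auto
  moreover have "{p \<in> motzkin_paths n. nat (path_y p n) = r} = paths_to n r" for r
    by (auto simp: paths_to_def dest: path_y_pos[OF assms])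
  ultimately show ?thesis by (simp add: path_sum_def)
qed

lemma sum_seg_weight:
  "(\<Sum>bs | segmented_perm n bs. seg_weight q u v bs) = (\<Sum>r\<le>n. seg_sum q u v n r)"
proof -
  have "length bs \<le> n" if "segmented_perm n bs" for bs
    using that length_le_length_concat[of bs] segmented_perm_length[OF that]
    by (simp add: Nil_notin_segmented_perm)
  then have "length ` {bs. segmented_perm n bs} \<subseteq> {..n}" by auto
  then have "(\<Sum>bs | segmented_perm n bs. seg_weight q u v bs) =
     (\<Sum>r\<le>n. \<Sum>bs | bs \<in> {bs. segmented_perm n bs} \<and> length bs = r. seg_weight q u v bs)"
    by (intro sum.group[symmetric] finite_segmented_perm) auto
  then show ?thesis by (simp add: seg_sum_def seg_perms_def)
qed

text \<open>Each adjacent pair inside a block is either an ascent or a descent, so every block falls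
  short of its length by one. This is why \<open>k + l < n\<close> covers all segmented permutations
  when \<open>n > 0\<close>.\<close>

lemma seg_adj_less_plus_greater:
  "distinct (concat bs) \<Longrightarrow> [] \<notin> set bs \<Longrightarrow>
   seg_adj (<) bs + seg_adj (>) bs + length bs = length (concat bs)"
proof (induction bs)
  case (Cons b bs)
  then show ?case using adj_less_plus_greater[of b] by auto
qed simp

text \<open>The sets \<open>SW n k l\<close> are the fibres of the map \<open>?g\<close>, so the
  double sum regroups a single sum over all segmented permutations.\<close>

lemma sum_SW:
  assumes "n > 0"
  shows "(\<Sum>(k, l)\<in>{(k, l). k + l < n}. u ^ k * v ^ l * (\<Sum>w\<in>SW n k l. q ^ sminv w)) =
    (\<Sum>bs | segmented_perm n bs. seg_weight q u v bs)"
proof -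
  let ?g = "\<lambda>bs. (seg_adj (<) bs, seg_adj (>) bs)"
  have SW: "SW n k l = {bs \<in> {bs. segmented_perm n bs}. ?g bs = (k, l)}" for k l
    by (auto simp: SW_def segmented_perm_def card_ascents card_descents)
  have "(\<Sum>(k, l)\<in>{(k, l). k + l < n}. u ^ k * v ^ l * (\<Sum>w\<in>SW n k l. q ^ sminv w)) =
     (\<Sum>kl\<in>{(k, l). k + l < n}. \<Sum>bs\<in>{bs \<in> {bs. segmented_perm n bs}. ?g bs = kl}. seg_weight q u v bs)"
    unfolding SW sum_distrib_left case_prod_beta prod.collapse
    by (intro sum.cong refl) (auto simp: seg_weight_def segmented_perm_def sminv_eq)
  also have "\<dots> = (\<Sum>bs | segmented_perm n bs. seg_weight q u v bs)"
  proof (rule sum.group[OF finite_segmented_perm])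
    show "finite {(k, l). k + l < n}"
      by (rule finite_subset[of _ "{..n} \<times> {..n}"]) auto
    show "?g ` {bs. segmented_perm n bs} \<subseteq> {(k, l). k + l < n}"
    proof clarify
      fix bs assume s: "segmented_perm n bs"
      then have "seg_adj (<) bs + seg_adj (>) bs + length bs = n"
        using seg_adj_less_plus_greater[of bs] segmented_perm_length[OF s]
        by (simp add: segmented_perm_def)
      moreover have "length bs > 0"
        using segmented_perm_length[OF s] assms by (cases bs) auto
      ultimately show "seg_adj (<) bs + seg_adj (>) bs < n" by linarith
    qed
  qed
  finally show ?thesis .
qed

theorem corollary6p4:
  fixes n :: nat and q u v :: "'a::comm_semiring_1"
  assumes "n > 0"
  shows "(\<Sum>(k, l)\<in>{(k, l). k + l < n}. u ^ k * v ^ l * (\<Sum>w\<in>SW n k l. q ^ sminv w)) =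
         (\<Sum>p\<in>motzkin_paths n. u ^ deg_theta p * v ^ deg_xi p * stair q p)"
proof -
  have "seg_sum q u v n = path_sum q u v n"
    by (intro ext seg_sum_eq_path_sum[OF assms])
  then show ?thesis
    unfolding sum_SW[OF assms] sum_seg_weight path_weight_def[symmetric] sum_path_weight[OF assms]
    by simp
qed

end
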